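(* Let $m,n$ be positive integers and let $(S,T)$ be a pair of random variables on a common probability space taking values in $\{0,1,\dots,m\}\times\{0,1,\dots,n\}$. For integers $1\le s\le k\le m$ and $1\le t\le l\le n$ define $$A^{(s,t)}_{k,l}=\frac{\displaystyle\sum_{i=s}^{k}\sum_{j=t}^{l}(-1)^{i+j-(s+t)}\binom{i-1}{i-s}\binom{m-i}{k-i}\binom{j-1}{j-t}\binom{n-j}{l-j}S_{i,j}}{\binom{m-s}{k-s}\binom{n-t}{l-t}},\qquad S_{i,j}=E\left[\binom{S}{i}\binom{T}{j}\right].$$ Then, for fixed $1\le s\le m$ and $1\le t\le n$, $A^{(s,t)}_{k,l}$ is non-increasing and convex in each of $k$ and $l$ separately, that is: (1) for each $t\le l\le n$: $A^{(s,t)}_{k,l}\ge A^{(s,t)}_{k+1,l}$ for $s\le k\le m-1$, and $A^{(s,t)}_{k,l}-A^{(s,t)}_{k+1,l}\ge A^{(s,t)}_{k+1,l}-A^{(s,t)}_{k+2,l}$ for $s\le k\le m-2$; (2) for each $s\le k\le m$: $A^{(s,t)}_{k,l}\ge A^{(s,t)}_{k,l+1}$ for $t\le l\le n-1$, and $A^{(s,t)}_{k,l}-A^{(s,t)}_{k,l+1}\ge A^{(s,t)}_{k,l+1}-A^{(s,t)}_{k,l+2}$ for $t\le l\le n-2$.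
   Context: For non-negative integers $a,r$, $\binom{a}{r}$ is the usual binomial coefficient, with $\binom{a}{0}=1$ and $\binom{a}{r}=0$ if $r>a$. $E$ denotes expectation. *)

theory Defs
  imports "HOL-Probability.Probability"
begin

definition binomial_moment ::
  "'a measure \<Rightarrow> ('a \<Rightarrow> nat) \<Rightarrow> ('a \<Rightarrow> nat) \<Rightarrow> nat \<Rightarrow> nat \<Rightarrow> real" where
  "binomial_moment M S T i j =
     prob_space.expectation M (\<lambda>\<omega>. real (S \<omega> choose i) * real (T \<omega> choose j))"

(* Meant for 1 \<le> s \<le> k \<le> m and 1 \<le> t \<le> l \<le> n, where none of the natural-number
   subtractions below truncates and the denominator is positive. *)
definition bonferroni_avg ::
  "'a measure \<Rightarrow> nat \<Rightarrow> nat \<Rightarrow> ('a \<Rightarrow> nat) \<Rightarrow> ('a \<Rightarrow> nat) \<Rightarrow> nat \<Rightarrow> nat \<Rightarrow> nat \<Rightarrow> nat \<Rightarrow> real" where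
  "bonferroni_avg M m n S T s t k l =
     (\<Sum>i = s..k. \<Sum>j = t..l.
        (-1) ^ (i + j - (s + t))
        * real ((i - 1) choose (i - s)) * real ((m - i) choose (k - i))
        * real ((j - 1) choose (j - t)) * real ((n - j) choose (l - j))
        * binomial_moment M S T i j)
     / (real ((m - s) choose (k - s)) * real ((n - t) choose (l - t)))"

end

theory Submission
  imports Defs
begin

text \<open>
  The double sum factorises, so $A_{k,l} = E[a_k(S)\, b_l(T)]$ where $a$ and $b$ are one-dimensional
  averages. With $c_j = \binom{m-j}{x-s} \binom{m}{s} / \binom{m}{x}$ one has
  $\binom{k}{s} a_k(x) = \sum_{j=s}^{k} \binom{j-1}{s-1} c_j$ for $s \le x$ (in a random ordering
  of an $m$-set, sum over the position $j$ of the $s$-th element of a fixed $x$-subset), whereas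
  $a_k(x) = 0$ for $x < s$.
  Thus $a_k(x)$ is a weighted mean of $c_s, \dots, c_k$, and it inherits from $c$ that it is
  non-negative, non-increasing and convex.
\<close>

text \<open>The average for a single count that is constantly \<open>x\<close>: this is a_k(x)
  above, and b_l(y) when \<open>n\<close>, \<open>t\<close>, \<open>l\<close>, \<open>y\<close>
  replace \<open>m\<close>, \<open>s\<close>, \<open>k\<close>, \<open>x\<close>.\<close>

definition bonferroni_avg1 :: "nat \<Rightarrow> nat \<Rightarrow> nat \<Rightarrow> nat \<Rightarrow> real" where
  "bonferroni_avg1 m s k x =
     (\<Sum>i = s..k. (-1) ^ (i - s) * real ((i - 1) choose (i - s)) * real ((m - i) choose (k - i))
        * real (x choose i)) / real ((m - s) choose (k - s))"

section \<open>Binomial identities\<close>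

text \<open>Inclusion-exclusion over the missing elements counts the z-subsets of an N-set that
  contain a given p-subset; their complements are the (N-z)-subsets of the other N-p points. The
  lower index \<open>N - z\<close>, instead of \<open>z - p\<close>, makes the right side vanish for
  \<open>z < p\<close> without truncated subtraction.\<close>

lemma alternating_sum_choose:
  assumes "p \<le> N" "z \<le> N"
  shows "(\<Sum>u\<le>p. (-1) ^ u * real (p choose u) * real ((N - u) choose z))
    = real ((N - p) choose (N - z))"
  using assms
proof (induction p arbitrary: N)
  case 0
  then show ?case using binomial_symmetric[of z N] by simp
next
  case (Suc p)
  obtain N' where N: "N = Suc N'" using Suc.prems by (cases N) auto
  have "(\<Sum>u\<le>Suc p. (-1) ^ u * real (Suc p choose u) * real ((N - u) choose z))
      = real (N choose z) + (\<Sum>u\<le>p. (-1) ^ Suc u * real (Suc p choose Suc u) * real ((N - Suc u) choose z))"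
    by (subst sum.atMost_Suc_shift) simp
  \<comment> \<open>Pascal's rule splits \<open>Suc p choose Suc u\<close>: one part restores the
    sum for \<open>p\<close> at \<open>N\<close>, the other is the sum for \<open>p\<close> at
    \<open>N - 1\<close>.\<close>
  also have "\<dots> = (real (N choose z)
        + (\<Sum>u\<le>p. (-1) ^ Suc u * real (p choose Suc u) * real ((N - Suc u) choose z)))
      - (\<Sum>u\<le>p. (-1) ^ u * real (p choose u) * real ((N' - u) choose z))"
    by (simp add: N algebra_simps sum.distrib sum_subtractf sum_negf)
  also have "real (N choose z)
        + (\<Sum>u\<le>p. (-1) ^ Suc u * real (p choose Suc u) * real ((N - Suc u) choose z))
      = (\<Sum>u\<le>Suc p. (-1) ^ u * real (p choose u) * real ((N - u) choose z))"
    by (subst sum.atMost_Suc_shift) simp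
  also have "\<dots> = (\<Sum>u\<le>p. (-1) ^ u * real (p choose u) * real ((N - u) choose z))"
    by simp
  also have "\<dots> = real ((N - p) choose (N - z))"
    using Suc.prems by (intro Suc.IH) auto
  also have "\<dots> - (\<Sum>u\<le>p. (-1) ^ u * real (p choose u) * real ((N' - u) choose z))
      = real ((N - Suc p) choose (N - z))"
  proof (cases "z \<le> N'")
    case True
    then have "(\<Sum>u\<le>p. (-1) ^ u * real (p choose u) * real ((N' - u) choose z))
        = real ((N' - p) choose (N' - z))"
      using Suc.prems N by (intro Suc.IH) auto
    then show ?thesis
      using True Suc.prems N by (simp add: Suc_diff_le)
  next
    \<comment> \<open>Here \<open>z = N\<close>, out of reach of the induction hypothesis at
      \<open>N'\<close>: every term of that sum is 0, and both remaining binomials have lower index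
      0.\<close>
    case False
    then show ?thesis using Suc.prems N by (simp add: binomial_eq_0)
  qed
  finally show ?case .
qed

lemma choose_mult_real:
  assumes "i \<le> k" "k \<le> m"
  shows "real (m choose i) * real ((m - i) choose (k - i)) = real (m choose k) * real (k choose i)"
  using choose_mult[OF assms] by (metis of_nat_mult)

text \<open>Both sides are the chance that an i-subset of an m-set lies in an x-subset, with the
  i-subset random on the left and the x-subset random on the right. The lower index
  \<open>m - x\<close> gives 0 for \<open>i > x\<close> and fits
  \<open>alternating_sum_choose\<close>.\<close>

lemma choose_ratio:
  assumes "i \<le> m" "x \<le> m"
  shows "real (x choose i) / real (m choose i) = real ((m - i) choose (m - x)) / real (m choose x)"
proof (cases "i \<le> x")
  case True
  have "(m - i) choose (m - x) = (m - i) choose (x - i)"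
    using True assms by (subst binomial_symmetric) auto
  moreover have "real (m choose i) > 0" "real (m choose x) > 0" using assms by simp_all
  ultimately show ?thesis
    using choose_mult_real[OF True assms(2)] by (simp add: field_simps)
next
  case False
  then show ?thesis using assms by (simp add: binomial_eq_0)
qed

section \<open>Recursion in k for the one-dimensional average\<close>

text \<open>Trinomial revision at \<open>i\<close> and at \<open>s\<close>, with
  \<open>m choose k\<close> cancelled, leaves \<open>k choose i\<close> as the only dependence on
  \<open>k\<close> in each summand, ready for Pascal's rule.\<close>

lemma choose_mult_bonferroni_avg1:
  assumes "s \<le> k" "k \<le> m" "1 \<le> s"
  shows "real (k choose s) * bonferroni_avg1 m s k x
    = real (m choose s) * (\<Sum>i = s..k. (-1) ^ (i - s) * real ((i - 1) choose (s - 1))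
        * (real (x choose i) / real (m choose i)) * real (k choose i))"
proof -
  have *: "real (k choose s) * ((-1) ^ (i - s) * real ((i - 1) choose (i - s))
        * real ((m - i) choose (k - i)) * real (x choose i) / real ((m - s) choose (k - s)))
      = real (m choose s) * ((-1) ^ (i - s) * real ((i - 1) choose (s - 1))
        * (real (x choose i) / real (m choose i)) * real (k choose i))"
    if i: "i \<in> {s..k}" for i
  proof -
    have sym: "(i - 1) choose (i - s) = (i - 1) choose (s - 1)"
      using i assms by (subst binomial_symmetric) auto
    have pos: "real (m choose i) > 0" "real (m choose k) > 0" "real ((m - s) choose (k - s)) > 0"
      using i assms by auto
    have e1: "real (m choose i) * real ((m - i) choose (k - i)) = real (m choose k) * real (k choose i)"
      using i assms by (intro choose_mult_real) auto
    have e2: "real (m choose s) * real ((m - s) choose (k - s)) = real (m choose k) * real (k choose s)"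
      using assms by (intro choose_mult_real) auto
    have "real (k choose s) * (real (m choose i) * real ((m - i) choose (k - i)))
        = real (m choose s) * real (k choose i) * real ((m - s) choose (k - s))"
      unfolding e1 using e2 by (simp add: mult_ac)
    then have e3: "real (k choose s) * real ((m - i) choose (k - i)) / real ((m - s) choose (k - s))
        = real (m choose s) * real (k choose i) / real (m choose i)"
      using pos by (simp add: field_simps)
    have "real (k choose s) * ((-1) ^ (i - s) * real ((i - 1) choose (i - s))
        * real ((m - i) choose (k - i)) * real (x choose i) / real ((m - s) choose (k - s)))
      = (-1) ^ (i - s) * real ((i - 1) choose (s - 1)) * real (x choose i)
        * (real (k choose s) * real ((m - i) choose (k - i)) / real ((m - s) choose (k - s)))"
      unfolding sym by simp
    also have "\<dots> = real (m choose s) * ((-1) ^ (i - s) * real ((i - 1) choose (s - 1))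
        * (real (x choose i) / real (m choose i)) * real (k choose i))"
      unfolding e3 by simp
    finally show ?thesis .
  qed
  show ?thesis
    unfolding bonferroni_avg1_def sum_divide_distrib sum_distrib_left
    by (rule sum.cong[OF refl *])
qed

text \<open>Incremental form of the sum of the c_j. Passing to \<open>Suc k\<close> turns
  \<open>k choose i\<close> into an increment \<open>k choose (i - 1)\<close>; trinomial revision
  extracts \<open>k choose (s - 1)\<close>, and an alternating sum remains.\<close>

lemma choose_mult_bonferroni_avg1_Suc:
  assumes "s \<le> k" "k < m" "1 \<le> s" "s \<le> x" "x \<le> m"
  shows "real (Suc k choose s) * bonferroni_avg1 m s (Suc k) x
    = real (k choose s) * bonferroni_avg1 m s k x
      + real (k choose (s - 1)) * (real (m choose s) / real (m choose x) * real ((m - Suc k) choose (x - s)))"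
proof -
  define \<beta> where "\<beta> i = (-1) ^ (i - s) * real ((i - 1) choose (s - 1))
    * (real (x choose i) / real (m choose i))" for i
  \<comment> \<open>The additional term is 0 since \<open>k choose Suc k = 0\<close>; both sums now
    have the same range.\<close>
  have ext: "(\<Sum>i = s..k. \<beta> i * real (k choose i)) = (\<Sum>i = s..Suc k. \<beta> i * real (k choose i))"
    using assms by simp
  have term_eq: "\<beta> i * real (Suc k choose i) - \<beta> i * real (k choose i)
      = real (k choose (s - 1)) / real (m choose x)
        * ((-1) ^ (i - s) * real ((Suc k - s) choose (i - s)) * real ((m - s - (i - s)) choose (m - x)))"
    if i: "i \<in> {s..Suc k}" for i
  proof -
    obtain j where j: "i = Suc j" using i assms by (cases i) auto
    obtain r where r: "s = Suc r" using assms by (cases s) auto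
    have "\<beta> i * real (Suc k choose i) - \<beta> i * real (k choose i) = \<beta> i * real (k choose j)"
      by (simp add: j algebra_simps)
    also have "\<dots> = (-1) ^ (i - s) * (real (k choose j) * real (j choose r))
        * (real ((m - i) choose (m - x)) / real (m choose x))"
      using i assms choose_ratio[of i m x] by (simp add: \<beta>_def j r)
    also have "real (k choose j) * real (j choose r) = real (k choose r) * real ((k - r) choose (j - r))"
      using i j r by (intro choose_mult_real[symmetric]) auto
    finally show ?thesis using i j r by simp
  qed
  have "(\<Sum>i = s..Suc k. \<beta> i * real (Suc k choose i)) - (\<Sum>i = s..k. \<beta> i * real (k choose i))
      = (\<Sum>i = s..Suc k. real (k choose (s - 1)) / real (m choose x)
        * ((-1) ^ (i - s) * real ((Suc k - s) choose (i - s)) * real ((m - s - (i - s)) choose (m - x))))"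
    unfolding ext sum_subtractf[symmetric] by (rule sum.cong[OF refl term_eq])
  also have "\<dots> = real (k choose (s - 1)) / real (m choose x)
      * (\<Sum>u\<le>Suc k - s. (-1) ^ u * real ((Suc k - s) choose u) * real ((m - s - u) choose (m - x)))"
    unfolding sum_distrib_left
    by (rule sum.reindex_bij_witness[of _ "\<lambda>u. u + s" "\<lambda>i. i - s"]) (use assms in auto)
  \<comment> \<open>The alternating sum with p = k+1-s, N = m-s and z = m-x.\<close>
  also have "\<dots> = real (k choose (s - 1)) / real (m choose x) * real ((m - Suc k) choose (x - s))"
    using assms by (subst alternating_sum_choose) auto
  finally have *: "(\<Sum>i = s..Suc k. \<beta> i * real (Suc k choose i))
      = (\<Sum>i = s..k. \<beta> i * real (k choose i))
        + real (k choose (s - 1)) / real (m choose x) * real ((m - Suc k) choose (x - s))"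
    by linarith
  show ?thesis
    using assms * choose_mult_bonferroni_avg1[of s "Suc k" m x] choose_mult_bonferroni_avg1[of s k m x]
    unfolding \<beta>_def[symmetric] by (simp add: algebra_simps)
qed

lemma bonferroni_avg1_start:
  assumes "1 \<le> s" "s \<le> x" "x \<le> m"
  shows "bonferroni_avg1 m s s x
    = real (m choose s) / real (m choose x) * real ((m - s) choose (x - s))"
proof -
  have "real (m choose s) * real ((m - s) choose (x - s)) = real (m choose x) * real (x choose s)"
    using assms by (intro choose_mult_real)
  then show ?thesis using assms by (simp add: bonferroni_avg1_def field_simps)
qed

text \<open>Division by \<open>Suc k choose s\<close> leaves the ratios (k+1-s)/(k+1) and s/(k+1),
  so the new average is a convex combination of the old one and c_{k+1}.\<close>

lemma bonferroni_avg1_Suc: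
  assumes "s \<le> k" "k < m" "1 \<le> s" "s \<le> x" "x \<le> m"
  shows "real (Suc k) * bonferroni_avg1 m s (Suc k) x
    = (real (Suc k) - real s) * bonferroni_avg1 m s k x
      + real s * (real (m choose s) / real (m choose x) * real ((m - Suc k) choose (x - s)))"
    (is "_ * ?B' = _ * ?B + _ * ?c")
proof -
  obtain r where r: "s = Suc r" using assms by (cases s) auto
  have "s * (Suc k choose s) = Suc k * (k choose (s - 1))"
    using Suc_times_binomial_eq[of k r] by (simp only: r diff_Suc_1 mult.commute)
  then have e1: "real s * real (Suc k choose s) = real (Suc k) * real (k choose (s - 1))"
    by (metis of_nat_mult)
  have "real (Suc k choose s) = real (k choose s) + real (k choose (s - 1))"
    by (simp add: r)
  then have e2: "(real (Suc k) - real s) * real (Suc k choose s) = real (Suc k) * real (k choose s)"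
    using e1 by (simp add: algebra_simps)
  have "real (Suc k choose s) * (real (Suc k) * ?B')
      = real (Suc k) * (real (Suc k choose s) * ?B')" by (simp only: mult_ac)
  also have "\<dots> = (real (Suc k) * real (k choose s)) * ?B + (real (Suc k) * real (k choose (s - 1))) * ?c"
    unfolding choose_mult_bonferroni_avg1_Suc[OF assms] by (simp only: distrib_left mult_ac)
  also have "\<dots> = real (Suc k choose s) * ((real (Suc k) - real s) * ?B + real s * ?c)"
    unfolding e1[symmetric] e2[symmetric] by (simp only: distrib_left mult_ac)
  finally show ?thesis
    using assms by (subst (asm) mult_cancel_left) auto
qed

section \<open>Weighted means of non-increasing and convex sequences\<close>

context
  fixes B c :: "nat \<Rightarrow> real" and s m :: nat
  assumes start: "B s = c s"
    and mean_step: "\<And>k. s \<le> k \<Longrightarrow> k < m \<Longrightarrow>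
      real (Suc k) * B (Suc k) = (real (Suc k) - real s) * B k + real s * c (Suc k)"
    and decreasing: "\<And>j. s \<le> j \<Longrightarrow> j < m \<Longrightarrow> c (Suc j) \<le> c j"
begin

text \<open>A mean of non-increasing terms is at least the last of them. Inductively,
  \<open>B (Suc k)\<close> mixes \<open>c (Suc k)\<close> with \<open>B k\<close>, which is at least
  \<open>c k\<close>.\<close>

lemma weighted_mean_ge: "s \<le> k \<Longrightarrow> k \<le> m \<Longrightarrow> c k \<le> B k"
proof (induction k rule: dec_induct)
  case base
  then show ?case using start by simp
next
  case (step k)
  have "(real (Suc k) - real s) * c (Suc k) \<le> (real (Suc k) - real s) * B k"
    using step decreasing[of k] by (intro mult_left_mono) auto
  then have "real (Suc k) * c (Suc k) \<le> real (Suc k) * B (Suc k)"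
    using mean_step[of k] step by (simp add: algebra_simps)
  then show ?case by (subst (asm) mult_le_cancel_left_pos) auto
qed

lemma weighted_mean_diff:
  "s \<le> k \<Longrightarrow> k < m \<Longrightarrow> real (Suc k) * (B k - B (Suc k)) = real s * (B k - c (Suc k))"
  using mean_step[of k] by (simp add: algebra_simps)

text \<open>The newly mixed-in value \<open>c (Suc k)\<close> is at most \<open>c k\<close>, hence
  at most the current mean \<open>B k\<close>.\<close>

lemma weighted_mean_decreasing:
  assumes "s \<le> k" "k < m"
  shows "B (Suc k) \<le> B k"
proof -
  have "0 \<le> real s * (B k - c (Suc k))"
    using weighted_mean_ge[of k] decreasing[of k] assms by simp
  then have "0 \<le> real (Suc k) * (B k - B (Suc k))"
    using weighted_mean_diff[OF assms] by simp
  then show ?thesis by (simp add: zero_le_mult_iff)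
qed

context
  assumes convex: "\<And>j. s \<le> j \<Longrightarrow> Suc j < m \<Longrightarrow> c (Suc j) - c (Suc (Suc j)) \<le> c j - c (Suc j)"
begin

text \<open>The differences of \<open>B\<close> obey a recursion of the same type, driven by the
  differences of \<open>c\<close>, with \<open>s + 1\<close> in the role of \<open>s\<close>: note
  k+1-s = (k+2)-(s+1).\<close>

lemma weighted_mean_diff_Suc:
  assumes "s \<le> k" "Suc k < m"
  shows "real (k + 2) * (B (Suc k) - B (Suc (Suc k)))
    = (real (Suc k) - real s) * (B k - B (Suc k)) + real s * (c (Suc k) - c (Suc (Suc k)))"
  using weighted_mean_diff[of k] weighted_mean_diff[of "Suc k"] assms by (simp add: algebra_simps)

text \<open>This is exactly what \<open>weighted_mean_diff_Suc\<close> requires for convexity. It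
  holds because \<open>B k - B (Suc k)\<close> is s/(s+1) times a weighted mean, with parameter s+1,
  of the differences of \<open>c\<close> up to \<open>c k - c (Suc k)\<close>, and these are
  non-increasing.\<close>

lemma weighted_mean_diff_ge:
  assumes "s \<le> k" "Suc k < m"
  shows "real s * (c (Suc k) - c (Suc (Suc k))) \<le> real (Suc s) * (B k - B (Suc k))"
  using assms
proof (induction k rule: dec_induct)
  case base
  have "real s * (c (Suc s) - c (Suc (Suc s))) \<le> real s * (c s - c (Suc s))"
    using convex[of s] base by (intro mult_left_mono) auto
  then show ?case using weighted_mean_diff[of s] base start by simp
next
  case (step k)
  define D D' d d' where "D = B k - B (Suc k)" and "D' = B (Suc k) - B (Suc (Suc k))"
    and "d = c (Suc k) - c (Suc (Suc k))" and "d' = c (Suc (Suc k)) - c (Suc (Suc (Suc k)))"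
  have IH: "real s * d \<le> real (Suc s) * D"
    using step by (simp add: D_def d_def)
  have rec: "real (k + 2) * D' = (real (Suc k) - real s) * D + real s * d"
    unfolding D_def D'_def d_def using step by (intro weighted_mean_diff_Suc) auto
  have "d' \<le> d" unfolding d_def d'_def using step by (intro convex) auto
  then have "real (k + 2) * (real s * d') \<le> real (k + 2) * (real s * d)"
    by (intro mult_left_mono) auto
  \<comment> \<open>With k+2 = (k+1-s) + (s+1), the induction hypothesis is applied to the first
    share only; the second already matches \<open>rec\<close> multiplied by s+1.\<close>
  also have "\<dots> = (real (Suc k) - real s) * (real s * d) + real (Suc s) * (real s * d)"
    by (simp add: algebra_simps)
  also have "\<dots> \<le> (real (Suc k) - real s) * (real (Suc s) * D) + real (Suc s) * (real s * d)"
    using IH step by (intro add_right_mono mult_left_mono) auto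
  also have "\<dots> = real (Suc s) * (real (k + 2) * D')"
    unfolding rec by (simp only: distrib_left mult_ac)
  also have "\<dots> = real (k + 2) * (real (Suc s) * D')" by (simp only: mult_ac)
  finally have "real s * d' \<le> real (Suc s) * D'"
    by (subst (asm) mult_le_cancel_left_pos) auto
  then show ?case by (simp add: D'_def d'_def)
qed

lemma weighted_mean_convex:
  assumes "s \<le> k" "Suc k < m"
  shows "B (Suc k) - B (Suc (Suc k)) \<le> B k - B (Suc k)"
proof -
  have "real (k + 2) * (B (Suc k) - B (Suc (Suc k))) \<le> real (k + 2) * (B k - B (Suc k))"
    unfolding weighted_mean_diff_Suc[OF assms]
    using weighted_mean_diff_ge[OF assms] by (simp add: algebra_simps)
  then show ?thesis by (subst (asm) mult_le_cancel_left_pos) auto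
qed

end

end

text \<open>By Pascal's rule the differences are \<open>N choose (r - 1)\<close> and
  \<open>Suc N choose (r - 1)\<close>, or both 0 if \<open>r = 0\<close>.\<close>

lemma choose_diff_mono:
  "real (Suc N choose r) - real (N choose r) \<le> real (Suc (Suc N) choose r) - real (Suc N choose r)"
  by (cases r) (auto simp: binomial_right_mono)

lemma bonferroni_avg1_eq_0: "x < s \<Longrightarrow> bonferroni_avg1 m s k x = 0"
  by (simp add: bonferroni_avg1_def binomial_eq_0)

section \<open>Sign, monotonicity and convexity of the one-dimensional average\<close>

context
  fixes m s x :: nat
  assumes s: "1 \<le> s" and x: "x \<le> m"
begin

text \<open>For \<open>s \<le> x\<close>, multiplying by \<open>(j - 1) choose (s - 1)\<close> gives
  \<open>m choose s\<close> times the probability that the s-th element of the x-subset has position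
  \<open>j\<close>. For \<open>x < s\<close> the difference \<open>x - s\<close> truncates, so that
  case is always split off.\<close>

private definition c where
  "c j = real (m choose s) / real (m choose x) * real ((m - j) choose (x - s))"

private lemma c_nonneg: "0 \<le> c j"
  by (simp add: c_def)

private lemma c_decreasing: "c (Suc j) \<le> c j"
  unfolding c_def by (intro mult_left_mono) (auto intro!: binomial_right_mono)

private lemma c_convex: "Suc j < m \<Longrightarrow> c (Suc j) - c (Suc (Suc j)) \<le> c j - c (Suc j)"
proof -
  assume j: "Suc j < m"
  \<comment> \<open>Reflecting j to m-j turns three consecutive indices into the upper indices N+2,
    N+1, N, and preserves convexity.\<close>
  define N where "N = m - Suc (Suc j)"
  have N: "m - Suc (Suc j) = N" "m - Suc j = Suc N" "m - j = Suc (Suc N)"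
    using j by (auto simp: N_def)
  show ?thesis
    unfolding c_def N right_diff_distrib[symmetric]
    by (intro mult_left_mono choose_diff_mono) simp
qed

private lemma avg1_start: "s \<le> x \<Longrightarrow> bonferroni_avg1 m s s x = c s"
  using s x by (simp add: bonferroni_avg1_start c_def)

private lemma avg1_step:
  "s \<le> x \<Longrightarrow> s \<le> k \<Longrightarrow> k < m \<Longrightarrow> real (Suc k) * bonferroni_avg1 m s (Suc k) x
     = (real (Suc k) - real s) * bonferroni_avg1 m s k x + real s * c (Suc k)"
  using s x by (simp only: bonferroni_avg1_Suc c_def)

text \<open>The mean is at least its last term, which is non-negative. This sign allows inequalities
  for one factor to be multiplied by the other.\<close>

lemma bonferroni_avg1_nonneg:
  assumes "s \<le> k" "k \<le> m"
  shows "0 \<le> bonferroni_avg1 m s k x"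
proof (cases "s \<le> x")
  case True
  have "c k \<le> bonferroni_avg1 m s k x"
    using assms
    by (intro weighted_mean_ge[of "\<lambda>k. bonferroni_avg1 m s k x" s c m])
      (simp_all only: avg1_start[OF True] avg1_step[OF True] c_decreasing)
  then show ?thesis using c_nonneg[of k] by simp
qed (simp add: bonferroni_avg1_eq_0)

lemma bonferroni_avg1_decreasing:
  assumes "s \<le> k" "k < m"
  shows "bonferroni_avg1 m s (Suc k) x \<le> bonferroni_avg1 m s k x"
proof (cases "s \<le> x")
  case True
  show ?thesis
    using assms
    by (intro weighted_mean_decreasing[of "\<lambda>k. bonferroni_avg1 m s k x" s c m])
      (simp_all only: avg1_start[OF True] avg1_step[OF True] c_decreasing)
qed (simp add: bonferroni_avg1_eq_0)

lemma bonferroni_avg1_convex: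
  assumes "s \<le> k" "Suc k < m"
  shows "bonferroni_avg1 m s (Suc k) x - bonferroni_avg1 m s (Suc (Suc k)) x
    \<le> bonferroni_avg1 m s k x - bonferroni_avg1 m s (Suc k) x"
proof (cases "s \<le> x")
  case True
  show ?thesis
    using assms
    by (intro weighted_mean_convex[of "\<lambda>k. bonferroni_avg1 m s k x" s c m])
      (simp_all only: avg1_start[OF True] avg1_step[OF True] c_decreasing c_convex)
qed (simp add: bonferroni_avg1_eq_0)

end

section \<open>Expectations of functions of the bounded pair\<close>

context prob_space
begin

context
  fixes S T :: "'a \<Rightarrow> nat" and m n :: nat
  assumes ST: "(\<lambda>\<omega>. (S \<omega>, T \<omega>)) \<in> measurable M (count_space ({0..m} \<times> {0..n}))"
begin

lemma bounded_pair_le: "\<omega> \<in> space M \<Longrightarrow> S \<omega> \<le> m \<and> T \<omega> \<le> n"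
  using measurable_space[OF ST] by auto

lemma integrable_bounded_pair:
  fixes f :: "nat \<Rightarrow> nat \<Rightarrow> real"
  shows "integrable M (\<lambda>\<omega>. f (S \<omega>) (T \<omega>))"
proof (rule integrable_const_bound)
  \<comment> \<open>On a finite grid, the sum of all absolute values is a uniform bound.\<close>
  show "AE \<omega> in M. norm (f (S \<omega>) (T \<omega>)) \<le> (\<Sum>x\<le>m. \<Sum>y\<le>n. \<bar>f x y\<bar>)"
  proof (rule AE_I2)
    fix \<omega> assume "\<omega> \<in> space M"
    then have le: "S \<omega> \<le> m" "T \<omega> \<le> n" using bounded_pair_le by auto
    have "\<bar>f (S \<omega>) (T \<omega>)\<bar> \<le> (\<Sum>y\<le>n. \<bar>f (S \<omega>) y\<bar>)"
      using le by (intro member_le_sum[of "T \<omega>" _ "\<lambda>y. \<bar>f (S \<omega>) y\<bar>"]) auto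
    also have "\<dots> \<le> (\<Sum>x\<le>m. \<Sum>y\<le>n. \<bar>f x y\<bar>)"
      using le by (intro member_le_sum[of "S \<omega>" _ "\<lambda>x. \<Sum>y\<le>n. \<bar>f x y\<bar>"]) (auto intro: sum_nonneg)
    finally show "norm (f (S \<omega>) (T \<omega>)) \<le> (\<Sum>x\<le>m. \<Sum>y\<le>n. \<bar>f x y\<bar>)" by simp
  qed
  have "(\<lambda>\<omega>. case_prod f (S \<omega>, T \<omega>)) \<in> borel_measurable M"
    by (rule measurable_compose[OF ST]) simp
  then show "(\<lambda>\<omega>. f (S \<omega>) (T \<omega>)) \<in> borel_measurable M" by simp
qed

text \<open>Linearity of expectation moves the finite double sum inside, where the summands split
  into a factor in \<open>i\<close> and a factor in \<open>j\<close>.\<close>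

lemma bonferroni_avg_eq_expectation:
  "bonferroni_avg M m n S T s t k l
     = expectation (\<lambda>\<omega>. bonferroni_avg1 m s k (S \<omega>) * bonferroni_avg1 n t l (T \<omega>))"
proof -
  define p where "p i = (-1) ^ (i - s) * real ((i - 1) choose (i - s)) * real ((m - i) choose (k - i))" for i
  define q where "q j = (-1) ^ (j - t) * real ((j - 1) choose (j - t)) * real ((n - j) choose (l - j))" for j
  define d where "d = real ((m - s) choose (k - s)) * real ((n - t) choose (l - t))"
  have "bonferroni_avg1 m s k x * bonferroni_avg1 n t l y
      = (\<Sum>i = s..k. \<Sum>j = t..l. p i * q j * (real (x choose i) * real (y choose j))) / d" for x y
    by (simp add: bonferroni_avg1_def p_def q_def d_def sum_product mult_ac)
  then have "expectation (\<lambda>\<omega>. bonferroni_avg1 m s k (S \<omega>) * bonferroni_avg1 n t l (T \<omega>))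
      = expectation (\<lambda>\<omega>. \<Sum>i = s..k. \<Sum>j = t..l. p i * q j * (real (S \<omega> choose i) * real (T \<omega> choose j))) / d"
    by simp
  also have "\<dots> = (\<Sum>i = s..k. \<Sum>j = t..l. p i * q j * binomial_moment M S T i j) / d"
    unfolding binomial_moment_def
    by (simp add: Bochner_Integration.integral_sum Bochner_Integration.integrable_sum
        integrable_bounded_pair[of "\<lambda>x y. real (x choose i) * real (y choose j)" for i j])
  also have "\<dots> = bonferroni_avg M m n S T s t k l"
  proof -
    \<comment> \<open>The ranges matter: \<open>s \<le> i\<close> and \<open>t \<le> j\<close> make
      the truncated exponents add up.\<close>
    have "(-1) ^ (i + j - (s + t)) = ((-1) ^ (i - s) * (-1) ^ (j - t) :: real)"
      if "i \<in> {s..k}" "j \<in> {t..l}" for i j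
      using that by (simp flip: power_add)
    then show ?thesis
      unfolding bonferroni_avg_def d_def p_def q_def
      by (intro arg_cong2[of _ _ _ _ "(/)"] sum.cong refl) (simp add: mult_ac)
  qed
  finally show ?thesis by simp
qed

text \<open>The pair never leaves the grid, so a comparison there suffices; the one-dimensional
  inequalities are available only for \<open>x \<le> m\<close> and \<open>y \<le> n\<close>.\<close>

lemma expectation_bounded_pair_mono:
  fixes f g :: "nat \<Rightarrow> nat \<Rightarrow> real"
  assumes "\<And>x y. x \<le> m \<Longrightarrow> y \<le> n \<Longrightarrow> f x y \<le> g x y"
  shows "expectation (\<lambda>\<omega>. f (S \<omega>) (T \<omega>)) \<le> expectation (\<lambda>\<omega>. g (S \<omega>) (T \<omega>))"
  using assms bounded_pair_le by (intro integral_mono integrable_bounded_pair) auto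

lemma expectation_bounded_pair_diff:
  fixes f g :: "nat \<Rightarrow> nat \<Rightarrow> real"
  shows "expectation (\<lambda>\<omega>. f (S \<omega>) (T \<omega>)) - expectation (\<lambda>\<omega>. g (S \<omega>) (T \<omega>))
    = expectation (\<lambda>\<omega>. f (S \<omega>) (T \<omega>) - g (S \<omega>) (T \<omega>))"
  by (intro Bochner_Integration.integral_diff[symmetric] integrable_bounded_pair)

section \<open>Monotonicity and convexity of the two-dimensional average\<close>

text \<open>At each value of the pair the first factor does not increase with \<open>k\<close>,
  while the second is fixed and non-negative; expectation preserves the inequality.\<close>

lemma bonferroni_avg_decreasing_left:
  assumes "1 \<le> s" "1 \<le> t" "t \<le> l" "l \<le> n" "s \<le> k" "k < m"
  shows "bonferroni_avg M m n S T s t (Suc k) l \<le> bonferroni_avg M m n S T s t k l"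
  unfolding bonferroni_avg_eq_expectation using assms
  by (intro expectation_bounded_pair_mono[of
        "\<lambda>x y. bonferroni_avg1 m s (Suc k) x * bonferroni_avg1 n t l y"
        "\<lambda>x y. bonferroni_avg1 m s k x * bonferroni_avg1 n t l y"]
      mult_right_mono bonferroni_avg1_decreasing bonferroni_avg1_nonneg)

lemma bonferroni_avg_decreasing_right:
  assumes "1 \<le> s" "1 \<le> t" "s \<le> k" "k \<le> m" "t \<le> l" "l < n"
  shows "bonferroni_avg M m n S T s t k (Suc l) \<le> bonferroni_avg M m n S T s t k l"
  unfolding bonferroni_avg_eq_expectation using assms
  by (intro expectation_bounded_pair_mono[of
        "\<lambda>x y. bonferroni_avg1 m s k x * bonferroni_avg1 n t (Suc l) y"
        "\<lambda>x y. bonferroni_avg1 m s k x * bonferroni_avg1 n t l y"]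
      mult_left_mono bonferroni_avg1_decreasing bonferroni_avg1_nonneg)

lemma bonferroni_avg_convex_left:
  assumes "1 \<le> s" "1 \<le> t" "t \<le> l" "l \<le> n" "s \<le> k" "Suc k < m"
  shows "bonferroni_avg M m n S T s t (Suc k) l - bonferroni_avg M m n S T s t (Suc (Suc k)) l
    \<le> bonferroni_avg M m n S T s t k l - bonferroni_avg M m n S T s t (Suc k) l"
proof -
  let ?f = "\<lambda>k x y. bonferroni_avg1 m s k x * bonferroni_avg1 n t l y"
  \<comment> \<open>Pulling out the common non-negative factor in \<open>y\<close> reduces this to
    one-dimensional convexity in \<open>k\<close>.\<close>
  have "?f (Suc k) x y - ?f (Suc (Suc k)) x y \<le> ?f k x y - ?f (Suc k) x y"
    if "x \<le> m" "y \<le> n" for x y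
    unfolding left_diff_distrib[symmetric] using assms that
    by (intro mult_right_mono bonferroni_avg1_convex bonferroni_avg1_nonneg)
  from expectation_bounded_pair_mono[OF this] show ?thesis
    unfolding bonferroni_avg_eq_expectation
      expectation_bounded_pair_diff[of "?f (Suc k)" "?f (Suc (Suc k))"]
      expectation_bounded_pair_diff[of "?f k" "?f (Suc k)"] .
qed

lemma bonferroni_avg_convex_right:
  assumes "1 \<le> s" "1 \<le> t" "s \<le> k" "k \<le> m" "t \<le> l" "Suc l < n"
  shows "bonferroni_avg M m n S T s t k (Suc l) - bonferroni_avg M m n S T s t k (Suc (Suc l))
    \<le> bonferroni_avg M m n S T s t k l - bonferroni_avg M m n S T s t k (Suc l)"
proof -
  let ?f = "\<lambda>l x y. bonferroni_avg1 m s k x * bonferroni_avg1 n t l y"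
  have "?f (Suc l) x y - ?f (Suc (Suc l)) x y \<le> ?f l x y - ?f (Suc l) x y"
    if "x \<le> m" "y \<le> n" for x y
    unfolding right_diff_distrib[symmetric] using assms that
    by (intro mult_left_mono bonferroni_avg1_convex bonferroni_avg1_nonneg)
  from expectation_bounded_pair_mono[OF this] show ?thesis
    unfolding bonferroni_avg_eq_expectation
      expectation_bounded_pair_diff[of "?f (Suc l)" "?f (Suc (Suc l))"]
      expectation_bounded_pair_diff[of "?f l" "?f (Suc l)"] .
qed

end

end

theorem mainTheorem8:
  fixes M :: "'a measure" and S T :: "'a \<Rightarrow> nat" and m n s t :: nat
  assumes "prob_space M"
    and "m \<ge> 1" and "n \<ge> 1"
    and "(\<lambda>\<omega>. (S \<omega>, T \<omega>)) \<in> measurable M (count_space ({0..m} \<times> {0..n}))"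
    and "1 \<le> s" and "s \<le> m" and "1 \<le> t" and "t \<le> n"
  defines "A \<equiv> bonferroni_avg M m n S T s t"
  shows "(\<forall>l. t \<le> l \<and> l \<le> n \<longrightarrow>
            (\<forall>k. s \<le> k \<and> k + 1 \<le> m \<longrightarrow> A k l \<ge> A (k + 1) l) \<and>
            (\<forall>k. s \<le> k \<and> k + 2 \<le> m \<longrightarrow>
                 A k l - A (k + 1) l \<ge> A (k + 1) l - A (k + 2) l)) \<and>
         (\<forall>k. s \<le> k \<and> k \<le> m \<longrightarrow>
            (\<forall>l. t \<le> l \<and> l + 1 \<le> n \<longrightarrow> A k l \<ge> A k (l + 1)) \<and>
            (\<forall>l. t \<le> l \<and> l + 2 \<le> n \<longrightarrow>
                 A k l - A k (l + 1) \<ge> A k (l + 1) - A k (l + 2)))"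
proof -
  interpret prob_space M by fact
  note ST = assms(4)
  have A: "A (k + 1) = A (Suc k)" "A (k + 2) = A (Suc (Suc k))"
    "A k (l + 1) = A k (Suc l)" "A k (l + 2) = A k (Suc (Suc l))" for k l
    by simp_all
  show ?thesis
    unfolding A unfolding A_def using assms(5,7)
    by (intro conjI allI impI bonferroni_avg_decreasing_left[OF ST]
        bonferroni_avg_decreasing_right[OF ST] bonferroni_avg_convex_left[OF ST]
        bonferroni_avg_convex_right[OF ST]) simp_all
qed

end
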